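(* Let $H$ be a real Hilbert space and let $A:D(A)\subset H\to H$ be a (possibly set-valued) maximal monotone operator with $F:=A^{-1}0=\{x\in D(A): 0\in Ax\}\neq\emptyset$. Let $(\beta_n)_{n\ge 0}$ be a sequence in $(0,\infty)$ with $\beta_n\to\infty$, let $(\alpha_n)_{n\ge 0}$ be a sequence in $\mathbb{R}$ with $\alpha_n\to 0$, let $(e_n)_{n\ge 0}$ be a sequence in $H$ with $\alpha_n e_n\to 0$ in norm, and let $(u_n)_{n\ge 0}$ be a sequence in $H$ with $u_n\to u$ in norm for some $u\in H$. Then for every $x_0\in H$ the sequence $(x_n)$ defined by $$x_{n+1}=(I+\beta_nA)^{-1}\big(u_n+\alpha_n(x_n+e_n)\big),\qquad n\ge 0,$$ converges strongly (in norm) to $P_Fu$, the metric projection of $u$ onto $F$.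
   Context: Let $H$ be a real Hilbert space with scalar product $(\cdot,\cdot)$ and norm $\|\cdot\|$. A possibly set-valued operator $A:D(A)\subset H\to H$ is identified with its graph $G(A)=\{[x,y]\in D(A)\times H: y\in Ax\}$. It is monotone if $(x_1-x_2,y_1-y_2)\ge 0$ for all $[x_1,y_1],[x_2,y_2]\in G(A)$, and maximal monotone if in addition $G(A)$ is not properly contained in the graph of any other monotone operator in $H$. For a maximal monotone $A$ and $\lambda>0$, the range of $I+\lambda A$ is all of $H$, and the resolvent $J_\lambda=(I+\lambda A)^{-1}:H\to H$ is everywhere defined, single-valued and nonexpansive. The set $F=A^{-1}0$ is closed and convex, so, when it is nonempty, $P_Fu$ denotes the unique point of $F$ nearest to $u$. *)

theory Defs
  imports "HOL-Analysis.Analysis"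
begin

text \<open>
  A set-valued operator is a function \<open>'a \<Rightarrow> 'a set\<close> with value \<open>{}\<close> outside its domain.
\<close>

definition op_dom :: "('a \<Rightarrow> 'a set) \<Rightarrow> 'a set" where
  "op_dom A = {x. A x \<noteq> {}}"

definition op_graph :: "('a \<Rightarrow> 'a set) \<Rightarrow> ('a \<times> 'a) set" where
  "op_graph A = {(x, y). x \<in> op_dom A \<and> y \<in> A x}"

definition op_inverse :: "('a \<Rightarrow> 'a set) \<Rightarrow> 'a \<Rightarrow> 'a set" where
  "op_inverse A y = {x \<in> op_dom A. y \<in> A x}"

definition monotone_op :: "('a::real_inner \<Rightarrow> 'a set) \<Rightarrow> bool" where
  "monotone_op A \<longleftrightarrow>
    (\<forall>(x1, y1) \<in> op_graph A. \<forall>(x2, y2) \<in> op_graph A. (x1 - x2) \<bullet> (y1 - y2) \<ge> 0)"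

definition maximal_monotone_op :: "('a::real_inner \<Rightarrow> 'a set) \<Rightarrow> bool" where
  "maximal_monotone_op A \<longleftrightarrow>
    monotone_op A \<and> \<not> (\<exists>B. monotone_op B \<and> op_graph A \<subset> op_graph B)"

definition id_plus_scaled :: "real \<Rightarrow> ('a::real_vector \<Rightarrow> 'a set) \<Rightarrow> 'a \<Rightarrow> 'a set" where
  "id_plus_scaled c A x = {x + c *\<^sub>R y | y. y \<in> A x}"

text \<open>
  For maximal monotone \<open>A\<close> on a Hilbert space and \<open>c > 0\<close>, the set-valued inverse of \<open>I + cA\<close> has
  exactly one value at every point (Minty's theorem); the resolvent selects it.
\<close>

definition resolvent :: "real \<Rightarrow> ('a::real_vector \<Rightarrow> 'a set) \<Rightarrow> 'a \<Rightarrow> 'a" where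
  "resolvent c A z = (THE x. x \<in> op_inverse (id_plus_scaled c A) z)"

text \<open>
  The library's \<open>closest_point\<close> requires the class \<open>heine_borel\<close>, which excludes
  infinite-dimensional Hilbert spaces.
\<close>

definition metric_proj :: "'a::metric_space set \<Rightarrow> 'a \<Rightarrow> 'a" where
  "metric_proj S u = (THE p. p \<in> S \<and> (\<forall>q\<in>S. dist u p \<le> dist u q))"

end

theory Submission
  imports Defs
begin

text \<open>
  Minty's theorem is obtained from the Fitzpatrick function
  \<open>\<phi>(x, s) = sup {x \<bullet> b + a \<bullet> s - a \<bullet> b | [a, b] \<in> G(A)}\<close>: as \<open>\<phi>(x, s) \<ge> x \<bullet> s\<close>, the strongly convex
  function \<open>\<phi>(q) + \<parallel>q\<parallel>\<^sup>2 / 2\<close> has a minimiser, and its optimality condition says that it solves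
  \<open>s \<in> A x\<close>, \<open>x + s = 0\<close>.

  For the convergence, put \<open>v\<^sub>\<beta> = u - J\<^sub>\<beta> u\<close>. Monotonicity yields
  \<open>\<parallel>v\<^sub>\<gamma> - v\<^sub>\<beta>\<parallel>\<^sup>2 \<le> \<parallel>v\<^sub>\<gamma>\<parallel>\<^sup>2 - \<parallel>v\<^sub>\<beta>\<parallel>\<^sup>2\<close> for \<open>\<beta> \<le> \<gamma>\<close>, and the same bound with \<open>u - p\<close>, \<open>p \<in> F\<close>, in
  place of \<open>v\<^sub>\<gamma>\<close>. Hence \<open>J\<^sub>\<beta> u\<close> converges strongly as \<open>\<beta> \<rightarrow> \<infinity>\<close>, without any appeal to weak
  compactness, and its limit is \<open>P\<^sub>F u\<close>. Nonexpansiveness of the resolvents makes \<open>(x\<^sub>n)\<close> a small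
  perturbation of this sequence.
\<close>

section \<open>Maximality as a membership criterion\<close>

lemma mem_op_graph_iff: "(x, y) \<in> op_graph A \<longleftrightarrow> y \<in> A x"
  by (auto simp: op_graph_def op_dom_def)

lemma monotone_opD:
  "monotone_op A \<Longrightarrow> y1 \<in> A x1 \<Longrightarrow> y2 \<in> A x2 \<Longrightarrow> (x1 - x2) \<bullet> (y1 - y2) \<ge> 0"
  unfolding monotone_op_def mem_op_graph_iff[symmetric] by blast

text \<open>The form in which maximality is used throughout: otherwise adjoining the single pair
  \<open>(x, y)\<close> would yield a strictly larger monotone graph.\<close>

lemma maximal_monotone_op_memI:
  assumes "maximal_monotone_op A" and rel: "\<And>a b. b \<in> A a \<Longrightarrow> (x - a) \<bullet> (y - b) \<ge> 0"
  shows "y \<in> A x"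
proof (rule ccontr)
  assume notin: "y \<notin> A x"
  define B where "B = A(x := insert y (A x))"
  have mono: "monotone_op A"
    using assms(1) by (simp add: maximal_monotone_op_def)
  have rel': "(a - x) \<bullet> (b - y) \<ge> 0" if "b \<in> A a" for a b
    using rel[OF that] by (metis inner_minus_left inner_minus_right minus_diff_eq)
  have memB: "b \<in> B a \<longleftrightarrow> b \<in> A a \<or> (a = x \<and> b = y)" for a b
    by (auto simp: B_def)
  have "monotone_op B"
    unfolding monotone_op_def using rel rel' monotone_opD[OF mono]
    by (auto simp: mem_op_graph_iff memB)
  moreover have "op_graph A \<subset> op_graph B"
  proof
    show "op_graph A \<subseteq> op_graph B" by (auto simp: mem_op_graph_iff memB)
    have "(x, y) \<in> op_graph B" "(x, y) \<notin> op_graph A"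
      using notin by (auto simp: mem_op_graph_iff memB)
    then show "op_graph A \<noteq> op_graph B" by blast
  qed
  ultimately show False
    using assms(1) by (auto simp: maximal_monotone_op_def)
qed

text \<open>Reduces Minty's theorem to one equation: for \<open>B = cA - z\<close>, the relation
  \<open>- x \<in> B x\<close> says exactly that \<open>z\<close> lies in
  \<open>x + c A x\<close>.\<close>

lemma maximal_monotone_op_affine:
  assumes max: "maximal_monotone_op A" and "c > 0"
  shows "maximal_monotone_op (\<lambda>x. {c *\<^sub>R y - z | y. y \<in> A x})" (is "maximal_monotone_op ?B")
proof -
  have mono: "monotone_op A"
    using max by (simp add: maximal_monotone_op_def)
  have "monotone_op ?B"
    unfolding monotone_op_def
  proof (clarsimp simp: mem_op_graph_iff)
    fix x1 x2 y1 y2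
    assume "y1 \<in> A x1" "y2 \<in> A x2"
    then have "0 \<le> c * ((x1 - x2) \<bullet> (y1 - y2))"
      using monotone_opD[OF mono] \<open>c > 0\<close> by simp
    then show "0 \<le> (x1 - x2) \<bullet> (c *\<^sub>R y1 - c *\<^sub>R y2)"
      by (simp add: scaleR_diff_right[symmetric])
  qed
  moreover have False if B': "monotone_op B'" "op_graph ?B \<subset> op_graph B'" for B'
  proof -
    from B'(2) obtain x y where "(x, y) \<in> op_graph B'" "(x, y) \<notin> op_graph ?B"
      by auto
    then have xy: "y \<in> B' x" "y \<notin> ?B x"
      unfolding mem_op_graph_iff by blast+
    \<comment> \<open>Undoing the map \<open>y \<mapsto> c y - z\<close> turns a pair that extends
      the graph of \<open>?B\<close> into one that is monotonically related to all of
      \<open>A\<close>.\<close>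
    have "(1 / c) *\<^sub>R (y + z) \<in> A x"
    proof (rule maximal_monotone_op_memI[OF max])
      fix a b
      assume "b \<in> A a"
      then have "c *\<^sub>R b - z \<in> B' a"
        using B'(2) by (auto simp: mem_op_graph_iff psubset_eq subset_iff)
      then have "0 \<le> (x - a) \<bullet> (y - (c *\<^sub>R b - z))"
        by (rule monotone_opD[OF B'(1) xy(1)])
      also have "y - (c *\<^sub>R b - z) = c *\<^sub>R ((1 / c) *\<^sub>R (y + z) - b)"
        using \<open>c > 0\<close> by (simp add: scaleR_diff_right algebra_simps)
      finally show "0 \<le> (x - a) \<bullet> ((1 / c) *\<^sub>R (y + z) - b)"
        using \<open>c > 0\<close> by (simp add: zero_le_mult_iff)
    qed
    moreover have "y = c *\<^sub>R ((1 / c) *\<^sub>R (y + z)) - z"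
      using \<open>c > 0\<close> by simp
    ultimately show False
      using xy(2) by blast
  qed
  ultimately show ?thesis
    by (auto simp: maximal_monotone_op_def)
qed

section \<open>Minimising a strongly convex function over an epigraph\<close>

text \<open>
  Here \<open>S\<close> plays the role of the epigraph of a closed convex function, which lets that function
  take the value \<open>\<infinity>\<close>.
\<close>

lemma closed_convex_epigraph_minimizer:
  fixes S :: "('b::{real_inner, complete_space} \<times> real) set"
  assumes "convex S" "closed S" "S \<noteq> {}"
    and nonneg: "\<And>q t. (q, t) \<in> S \<Longrightarrow> t + (norm q)\<^sup>2 / 2 \<ge> 0"
  obtains q t where "(q, t) \<in> S"
    and "\<And>r s. (r, s) \<in> S \<Longrightarrow> t + (norm q)\<^sup>2 / 2 \<le> s + (norm r)\<^sup>2 / 2"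
proof -
  define V :: "'b \<times> real \<Rightarrow> real" where "V = (\<lambda>(q, t). t + (norm q)\<^sup>2 / 2)"
  define m where "m = Inf (V ` S)"
  have bdd: "bdd_below (V ` S)"
    by (rule bdd_belowI[of _ 0]) (auto simp: V_def nonneg)
  have lower: "m \<le> V p" if "p \<in> S" for p
    unfolding m_def using bdd that by (auto intro: cInf_lower)
  have "\<exists>p\<in>S. V p < m + inverse (real (Suc n))" for n
    using cInf_lessD[of "V ` S" "m + inverse (real (Suc n))"] \<open>S \<noteq> {}\<close>
    by (auto simp: m_def)
  then obtain p where p: "\<And>n. p n \<in> S" "\<And>n. V (p n) < m + inverse (real (Suc n))"
    by metis
  define q t where "q = fst \<circ> p" and "t = snd \<circ> p"
  have Vp: "V (p n) = t n + (norm (q n))\<^sup>2 / 2" for n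
    by (simp add: V_def q_def t_def case_prod_unfold)
  \<comment> \<open>The value of \<open>V\<close> at the midpoint is at least \<open>m\<close>,
    while the two endpoint values exceed \<open>m\<close> only slightly; by the parallelogram law
    the gap controls the distance.\<close>
  have Cauchy_bound:
    "(norm (q i - q j))\<^sup>2 \<le> 4 * (inverse (real (Suc i)) + inverse (real (Suc j)))" for i j
  proof -
    have "(1/2) *\<^sub>R p i + (1/2) *\<^sub>R p j \<in> S"
      using \<open>convex S\<close> p(1) by (auto simp: convex_def)
    from lower[OF this] have
      "m \<le> (t i + t j) / 2 + (norm ((1/2) *\<^sub>R q i + (1/2) *\<^sub>R q j))\<^sup>2 / 2"
      by (simp add: V_def q_def t_def case_prod_unfold add_divide_distrib)
    moreover have "(norm (q i - q j))\<^sup>2 / 8 =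
        (norm (q i))\<^sup>2 / 4 + (norm (q j))\<^sup>2 / 4 - (norm ((1/2) *\<^sub>R q i + (1/2) *\<^sub>R q j))\<^sup>2 / 2"
      by (simp add: power2_norm_eq_inner inner_diff inner_add inner_commute field_simps)
    ultimately show ?thesis
      using p(2)[of i] p(2)[of j] unfolding Vp by argo
  qed
  have inv0: "(\<lambda>n. inverse (real (Suc n))) \<longlonglongrightarrow> 0"
    by (rule LIMSEQ_inverse_real_of_nat)
  have "Cauchy q"
  proof (rule CauchyI)
    fix \<epsilon> :: real
    assume "\<epsilon> > 0"
    then have "\<forall>\<^sub>F n in sequentially. inverse (real (Suc n)) < \<epsilon>\<^sup>2 / 8"
      by (intro order_tendstoD(2)[OF inv0]) simp
    then obtain M where M: "\<And>n. n \<ge> M \<Longrightarrow> inverse (real (Suc n)) < \<epsilon>\<^sup>2 / 8"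
      by (auto simp: eventually_sequentially)
    have "norm (q i - q j) < \<epsilon>" if "i \<ge> M" "j \<ge> M" for i j
    proof (rule power_less_imp_less_base[where n = 2])
      show "(norm (q i - q j))\<^sup>2 < \<epsilon>\<^sup>2"
        using Cauchy_bound[of i j] M[OF that(1)] M[OF that(2)] by argo
    qed (use \<open>\<epsilon> > 0\<close> in simp)
    then show "\<exists>M. \<forall>i\<ge>M. \<forall>j\<ge>M. norm (q i - q j) < \<epsilon>"
      by blast
  qed
  then obtain q' where q': "q \<longlonglongrightarrow> q'"
    using Cauchy_convergent convergent_def by blast
  have Vlim: "(\<lambda>n. V (p n)) \<longlonglongrightarrow> m"
  proof (rule tendsto_sandwich)
    show "\<forall>\<^sub>F n in sequentially. m \<le> V (p n)"
      "\<forall>\<^sub>F n in sequentially. V (p n) \<le> m + inverse (real (Suc n))"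
      using lower[OF p(1)] less_imp_le[OF p(2)] by (auto intro: always_eventually)
    show "(\<lambda>n. m + inverse (real (Suc n))) \<longlonglongrightarrow> m"
      using tendsto_add[OF tendsto_const inv0, of m] by simp
  qed simp
  \<comment> \<open>The estimate above controls only the first components. The heights converge
    because both \<open>V (p n)\<close> and \<open>q n\<close> do, and the limit has
    \<open>V\<close> exactly \<open>m\<close>.\<close>
  have "t = (\<lambda>n. V (p n) - (norm (q n))\<^sup>2 / 2)"
    by (simp add: Vp)
  moreover have "(\<lambda>n. V (p n) - (norm (q n))\<^sup>2 / 2) \<longlonglongrightarrow> m - (norm q')\<^sup>2 / 2"
    by (intro tendsto_intros Vlim q') simp
  ultimately have t': "t \<longlonglongrightarrow> m - (norm q')\<^sup>2 / 2"
    by simp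
  have "p = (\<lambda>n. (q n, t n))"
    by (simp add: q_def t_def)
  then have "p \<longlonglongrightarrow> (q', m - (norm q')\<^sup>2 / 2)"
    using tendsto_Pair[OF q' t'] by simp
  then have "(q', m - (norm q')\<^sup>2 / 2) \<in> S"
    using \<open>closed S\<close> p(1) closed_sequentially by blast
  then show thesis
    by (rule that) (use lower in \<open>force simp: V_def\<close>)
qed

text \<open>First-order optimality, saying that \<open>- q\<close> is a subgradient at
  \<open>q\<close>: compare the minimiser with points on the segment towards \<open>(r, s)\<close>,
  divide by the step \<open>k\<close> and let \<open>k\<close> tend to 0.\<close>

lemma convex_minimizer_variational_inequality:
  fixes S :: "('b::real_inner \<times> real) set"
  assumes "convex S" and qt: "(q, t) \<in> S" and rs: "(r, s) \<in> S"
    and min: "\<And>r s. (r, s) \<in> S \<Longrightarrow> t + (norm q)\<^sup>2 / 2 \<le> s + (norm r)\<^sup>2 / 2"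
  shows "t - q \<bullet> (r - q) \<le> s"
proof -
  have ineq: "0 \<le> (s - t + q \<bullet> (r - q)) + k * ((norm (r - q))\<^sup>2 / 2)" if k: "0 < k" "k < 1" for k
  proof -
    have "(1 - k) *\<^sub>R (q, t) + k *\<^sub>R (r, s) \<in> S"
      using convexD_alt[OF \<open>convex S\<close> qt rs, of k] k by simp
    moreover have "(1 - k) *\<^sub>R (q, t) + k *\<^sub>R (r, s) = (q + k *\<^sub>R (r - q), t + k * (s - t))"
      by (simp add: algebra_simps)
    ultimately have "t + (norm q)\<^sup>2 / 2 \<le> t + k * (s - t) + (norm (q + k *\<^sub>R (r - q)))\<^sup>2 / 2"
      using min by metis
    also have "(norm (q + k *\<^sub>R (r - q)))\<^sup>2 =
        (norm q)\<^sup>2 + 2 * k * (q \<bullet> (r - q)) + k\<^sup>2 * (norm (r - q))\<^sup>2"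
      unfolding power2_norm_eq_inner
      by (simp add: inner_add inner_commute power2_eq_square)
    finally have "0 \<le> k * ((s - t + q \<bullet> (r - q)) + k * ((norm (r - q))\<^sup>2 / 2))"
      by (simp add: field_simps power2_eq_square)
    then show ?thesis
      using k by (simp add: zero_le_mult_iff)
  qed
  have "((\<lambda>k. (s - t + q \<bullet> (r - q)) + k * ((norm (r - q))\<^sup>2 / 2)) \<longlongrightarrow>
      (s - t + q \<bullet> (r - q)) + 0 * ((norm (r - q))\<^sup>2 / 2)) (at_right 0)"
    by (intro tendsto_intros)
  moreover have "\<forall>\<^sub>F k in at_right (0::real). 0 < k \<and> k < 1"
    by (simp add: eventually_at_right[of 0 1]) (auto intro: exI[of _ 1])
  then have "\<forall>\<^sub>F k in at_right 0. 0 \<le> (s - t + q \<bullet> (r - q)) + k * ((norm (r - q))\<^sup>2 / 2)"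
    by (rule eventually_mono) (use ineq in blast)
  ultimately have "0 \<le> (s - t + q \<bullet> (r - q)) + 0 * ((norm (r - q))\<^sup>2 / 2)"
    by (intro tendsto_lowerbound) auto
  then show ?thesis by simp
qed

section \<open>Minty's theorem\<close>

lemma maximal_monotone_op_Minty_zero:
  fixes A :: "'a::{real_inner, complete_space} \<Rightarrow> 'a set"
  assumes max: "maximal_monotone_op A"
  shows "\<exists>x. - x \<in> A x"
proof -
  have mono: "monotone_op A"
    using max by (simp add: maximal_monotone_op_def)
  \<comment> \<open>The epigraph of the Fitzpatrick function: each graph pair contributes one closed
    half-space, which makes \<open>S\<close> closed and convex.\<close>
  define S :: "(('a \<times> 'a) \<times> real) set" where
    "S = {p. \<forall>a b. b \<in> A a \<longrightarrow> fst p \<bullet> (b, a) - snd p \<le> a \<bullet> b}"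
  have S_iff: "((x, s), t) \<in> S \<longleftrightarrow> (\<forall>a b. b \<in> A a \<longrightarrow> x \<bullet> b + s \<bullet> a - a \<bullet> b \<le> t)" for x s t
    by (auto simp: S_def algebra_simps)
  have "closed S"
    unfolding S_def
    by (intro closed_Collect_all closed_Collect_imp closed_Collect_le continuous_intros) auto
  have "convex S"
    unfolding convex_def S_def
  proof clarsimp
    fix x s x' s' a b :: 'a and t t' k l :: real
    assume "\<forall>a b. b \<in> A a \<longrightarrow> x \<bullet> b + s \<bullet> a - t \<le> a \<bullet> b"
      "\<forall>a b. b \<in> A a \<longrightarrow> x' \<bullet> b + s' \<bullet> a - t' \<le> a \<bullet> b"
      "0 \<le> k" "0 \<le> l" "k + l = 1" "b \<in> A a"
    then have "k * (x \<bullet> b + s \<bullet> a - t) + l * (x' \<bullet> b + s' \<bullet> a - t') \<le> a \<bullet> b"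
      by (intro convex_bound_le) auto
    then show "(k *\<^sub>R x + l *\<^sub>R x') \<bullet> b + (k *\<^sub>R s + l *\<^sub>R s') \<bullet> a - (k * t + l * t') \<le> a \<bullet> b"
      by (simp add: inner_add algebra_simps)
  qed
  have graph_S: "((a, b), a \<bullet> b) \<in> S" if "b \<in> A a" for a b
    unfolding S_iff
  proof (intro allI impI)
    fix a' b'
    assume "b' \<in> A a'"
    from monotone_opD[OF mono that this] show "a \<bullet> b' + b \<bullet> a' - a' \<bullet> b' \<le> a \<bullet> b"
      by (simp add: inner_diff inner_commute)
  qed
  \<comment> \<open>With an empty graph the membership criterion would hold vacuously and put every
    pair into it.\<close>
  have "\<exists>a b. b \<in> A a"
    using maximal_monotone_op_memI[OF max] by blast
  with graph_S have "S \<noteq> {}" by blast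
  \<comment> \<open>If \<open>t < x \<bullet> s\<close>, then \<open>(x, s)\<close> is strictly
    related to every graph pair. Maximality makes it a graph pair itself, and comparing it with
    itself gives \<open>0 > 0\<close>.\<close>
  have inner_le: "x \<bullet> s \<le> t" if "((x, s), t) \<in> S" for x s t
  proof (rule ccontr)
    assume neg: "\<not> x \<bullet> s \<le> t"
    have pos: "(x - a) \<bullet> (s - b) > 0" if "b \<in> A a" for a b
      using \<open>((x, s), t) \<in> S\<close> that neg
      unfolding S_iff by (fastforce simp: inner_diff inner_commute)
    then have "s \<in> A x"
      by (intro maximal_monotone_op_memI[OF max] less_imp_le)
    from pos[OF this] show False by simp
  qed
  have half: "(norm (x + s))\<^sup>2 / 2 = x \<bullet> s + (norm (x, s))\<^sup>2 / 2" for x s :: 'a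
    by (simp add: power2_norm_eq_inner inner_add inner_commute)
  have "t + (norm q)\<^sup>2 / 2 \<ge> 0" if "(q, t) \<in> S" for q t
  proof -
    obtain x s where q: "q = (x, s)" by force
    have "0 \<le> (norm (x + s))\<^sup>2 / 2" by simp
    then show ?thesis
      using inner_le[of x s t] that unfolding half q by linarith
  qed
  then obtain q t where qt: "(q, t) \<in> S"
    and min: "\<And>r s. (r, s) \<in> S \<Longrightarrow> t + (norm q)\<^sup>2 / 2 \<le> s + (norm r)\<^sup>2 / 2"
    using closed_convex_epigraph_minimizer[OF \<open>convex S\<close> \<open>closed S\<close> \<open>S \<noteq> {}\<close>] by metis
  obtain x s where q: "q = (x, s)" by force
  \<comment> \<open>Adding \<open>x \<bullet> s\<close> to the optimality condition tested at
    \<open>(a, b)\<close> completes both products, so \<open>(- s, - x)\<close> is monotonically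
    related to the graph.\<close>
  have key: "(norm (x + s))\<^sup>2 \<le> (- s - a) \<bullet> (- x - b)" if "b \<in> A a" for a b
  proof -
    have "t - q \<bullet> ((a, b) - q) \<le> a \<bullet> b"
      by (rule convex_minimizer_variational_inequality[OF \<open>convex S\<close> qt graph_S[OF that] min])
    moreover have "x \<bullet> s \<le> t"
      using inner_le qt q by simp
    ultimately show ?thesis
      by (simp add: q power2_norm_eq_inner inner_diff inner_add inner_commute)
  qed
  have "- x \<in> A (- s)"
    by (rule maximal_monotone_op_memI[OF max]) (meson key order_trans zero_le_power2)
  \<comment> \<open>Testing \<open>key\<close> at the pair \<open>(- s, - x)\<close> itself makes
    its right-hand side vanish.\<close>
  moreover from key[OF this] have "- s = x"
    by (simp add: neg_eq_iff_add_eq_0 add.commute)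
  ultimately show ?thesis by metis
qed

theorem maximal_monotone_op_Minty:
  fixes A :: "'a::{real_inner, complete_space} \<Rightarrow> 'a set"
  assumes "maximal_monotone_op A" "c > 0"
  obtains x y where "y \<in> A x" "x + c *\<^sub>R y = z"
proof -
  obtain x y where "- x = c *\<^sub>R y - z" "y \<in> A x"
    using maximal_monotone_op_Minty_zero[OF maximal_monotone_op_affine[OF assms, of z]] by auto
  then show thesis
    by (intro that[of y x]) (auto simp: algebra_simps)
qed

section \<open>Resolvents\<close>

text \<open>Serves twice: equal right-hand points give uniqueness of the resolvent value, arbitrary
  ones its nonexpansiveness.\<close>

lemma monotone_op_resolvent_dist_le:
  assumes "monotone_op A" "c > 0" "y1 \<in> A x1" "y2 \<in> A x2"
  shows "dist x1 x2 \<le> dist (x1 + c *\<^sub>R y1) (x2 + c *\<^sub>R y2)"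
proof -
  have "0 \<le> c * ((x1 - x2) \<bullet> (y1 - y2))"
    using monotone_opD[OF assms(1,3,4)] \<open>c > 0\<close> by simp
  then have "(norm (x1 - x2))\<^sup>2 \<le> (x1 - x2) \<bullet> ((x1 - x2) + c *\<^sub>R (y1 - y2))"
    by (simp add: inner_add_right power2_norm_eq_inner)
  also have "\<dots> \<le> norm (x1 - x2) * norm ((x1 - x2) + c *\<^sub>R (y1 - y2))"
    by (rule norm_cauchy_schwarz)
  finally have "norm (x1 - x2) \<le> norm ((x1 - x2) + c *\<^sub>R (y1 - y2))"
    by (cases "x1 = x2") (auto simp: power2_eq_square)
  also have "(x1 - x2) + c *\<^sub>R (y1 - y2) = (x1 + c *\<^sub>R y1) - (x2 + c *\<^sub>R y2)"
    by (simp add: algebra_simps)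
  finally show ?thesis
    by (simp add: dist_norm)
qed

lemma mem_op_inverse_id_plus_scaled_iff:
  "x \<in> op_inverse (id_plus_scaled c A) z \<longleftrightarrow> (\<exists>y\<in>A x. z = x + c *\<^sub>R y)"
  by (auto simp: op_inverse_def op_dom_def id_plus_scaled_def)

text \<open>The element on the left is the Yosida approximation of \<open>A\<close> at
  \<open>z\<close>. Minty's theorem and the preceding distance bound justify the definite
  description in \<open>resolvent\<close>.\<close>

lemma resolvent_mem:
  fixes A :: "'a::{real_inner, complete_space} \<Rightarrow> 'a set"
  assumes max: "maximal_monotone_op A" and "c > 0"
  shows "(1 / c) *\<^sub>R (z - resolvent c A z) \<in> A (resolvent c A z)"
proof -
  have mono: "monotone_op A"
    using max by (simp add: maximal_monotone_op_def)
  obtain x y where xy: "y \<in> A x" "x + c *\<^sub>R y = z"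
    using maximal_monotone_op_Minty[OF assms] .
  have "resolvent c A z = x"
    unfolding resolvent_def mem_op_inverse_id_plus_scaled_iff
  proof (rule the_equality)
    fix x'
    assume "\<exists>y\<in>A x'. z = x' + c *\<^sub>R y"
    then show "x' = x"
      using monotone_op_resolvent_dist_le[OF mono \<open>c > 0\<close> _ xy(1)] xy(2) by fastforce
  qed (use xy in auto)
  with xy \<open>c > 0\<close> show ?thesis by auto
qed

lemma resolvent_nonexpansive:
  fixes A :: "'a::{real_inner, complete_space} \<Rightarrow> 'a set"
  assumes "maximal_monotone_op A" "c > 0"
  shows "dist (resolvent c A z) (resolvent c A w) \<le> dist z w"
proof -
  have "monotone_op A"
    using assms(1) by (simp add: maximal_monotone_op_def)
  from monotone_op_resolvent_dist_le[OF this assms(2) resolvent_mem[OF assms, of z]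
      resolvent_mem[OF assms, of w]]
  show ?thesis using assms(2) by simp
qed

section \<open>Strong convergence of the resolvents at a fixed point\<close>

text \<open>Being related to a given graph pair is a closed condition, and maximality turns it back
  into membership.\<close>

lemma maximal_monotone_op_graph_closed:
  assumes max: "maximal_monotone_op A" and "\<And>n. y n \<in> A (x n)"
    and "x \<longlonglongrightarrow> x'" "y \<longlonglongrightarrow> y'"
  shows "y' \<in> A x'"
proof (rule maximal_monotone_op_memI[OF max])
  fix a b
  assume "b \<in> A a"
  moreover have "monotone_op A"
    using max by (simp add: maximal_monotone_op_def)
  ultimately have "0 \<le> (x n - a) \<bullet> (y n - b)" for n
    using assms(2) monotone_opD by blast
  moreover have "(\<lambda>n. (x n - a) \<bullet> (y n - b)) \<longlonglongrightarrow> (x' - a) \<bullet> (y' - b)"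
    by (intro tendsto_intros assms)
  ultimately show "0 \<le> (x' - a) \<bullet> (y' - b)"
    by (intro LIMSEQ_le_const) auto
qed

text \<open>Rests on the identity \<open>eq\<close>. For \<open>a > b\<close> it makes
  \<open>(norm w)\<^sup>2 - (norm v)\<^sup>2\<close> nonnegative, so that its factor
  \<open>a - b\<close> may be enlarged to \<open>a + b\<close> and cancelled. Here \<open>a\<close>
  and \<open>b\<close> will be reciprocals of \<beta> values, or \<open>b = 0\<close> for zeros of
  \<open>A\<close>.\<close>

lemma norm_diff_sq_le_of_inner_scaled:
  fixes v w :: "'a::real_inner"
  assumes "0 \<le> b" "b \<le> a" "0 < a" and inner: "0 \<le> (w - v) \<bullet> (a *\<^sub>R v - b *\<^sub>R w)"
  shows "(norm (w - v))\<^sup>2 \<le> (norm w)\<^sup>2 - (norm v)\<^sup>2"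
proof -
  have eq: "(a + b) * (norm (w - v))\<^sup>2 + 2 * ((w - v) \<bullet> (a *\<^sub>R v - b *\<^sub>R w)) =
      (a - b) * ((norm w)\<^sup>2 - (norm v)\<^sup>2)"
    by (simp add: power2_norm_eq_inner inner_diff inner_commute algebra_simps)
  then have le: "(a + b) * (norm (w - v))\<^sup>2 \<le> (a - b) * ((norm w)\<^sup>2 - (norm v)\<^sup>2)"
    using inner by linarith
  have lhs: "0 \<le> (a + b) * (norm (w - v))\<^sup>2"
    using assms by simp
  show ?thesis
  proof (cases "a = b")
    case True
    then have "w = v"
      using le assms by (simp add: mult_le_0_iff)
    then show ?thesis by simp
  next
    case False
    then have "0 \<le> (norm w)\<^sup>2 - (norm v)\<^sup>2"
      using le lhs assms by (smt (verit) mult_pos_neg)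
    then have "(a - b) * ((norm w)\<^sup>2 - (norm v)\<^sup>2) \<le> (a + b) * ((norm w)\<^sup>2 - (norm v)\<^sup>2)"
      using assms by (intro mult_right_mono) auto
    with le have "(a + b) * (norm (w - v))\<^sup>2 \<le> (a + b) * ((norm w)\<^sup>2 - (norm v)\<^sup>2)"
      by linarith
    then show ?thesis
      using assms by (simp add: mult_le_cancel_left)
  qed
qed

text \<open>Choose \<open>k\<close> with squared norm close to the supremum; every
  \<open>v n\<close> with \<open>\<beta> k \<le> \<beta> n\<close> is then close to
  \<open>v k\<close>. Since \<beta> may oscillate, indices are compared through its values, and
  divergence supplies this inequality for all large \<open>n\<close>.\<close>

lemma Cauchy_of_norm_sq_monotone:
  fixes v :: "nat \<Rightarrow> 'a::real_inner" and \<beta> :: "nat \<Rightarrow> real"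
  assumes lim: "filterlim \<beta> at_top sequentially"
    and incr: "\<And>m n. \<beta> m \<le> \<beta> n \<Longrightarrow> (norm (v n - v m))\<^sup>2 \<le> (norm (v n))\<^sup>2 - (norm (v m))\<^sup>2"
    and bound: "\<And>n. (norm (v n))\<^sup>2 \<le> C"
  shows "Cauchy v"
proof (rule CauchyI)
  fix \<epsilon> :: real
  assume "\<epsilon> > 0"
  define L where "L = (SUP n. (norm (v n))\<^sup>2)"
  have bdd: "bdd_above (range (\<lambda>n. (norm (v n))\<^sup>2))"
    using bound by (intro bdd_aboveI[of _ C]) auto
  have upper: "(norm (v n))\<^sup>2 \<le> L" for n
    unfolding L_def by (rule cSUP_upper[OF _ bdd]) simp
  have "L - (\<epsilon> / 2)\<^sup>2 < L"
    using \<open>\<epsilon> > 0\<close> by simp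
  then obtain k where k: "L - (\<epsilon> / 2)\<^sup>2 < (norm (v k))\<^sup>2"
    using less_cSUP_iff[OF _ bdd] by (auto simp: L_def)
  obtain M where M: "\<And>n. n \<ge> M \<Longrightarrow> \<beta> k \<le> \<beta> n"
    using lim by (auto simp: filterlim_at_top eventually_sequentially)
  have near: "norm (v n - v k) < \<epsilon> / 2" if "n \<ge> M" for n
  proof (rule power_less_imp_less_base[where n = 2])
    show "(norm (v n - v k))\<^sup>2 < (\<epsilon> / 2)\<^sup>2"
      using incr[OF M[OF that]] upper[of n] k by linarith
  qed (use \<open>\<epsilon> > 0\<close> in simp)
  have "norm (v i - v j) < \<epsilon>" if "i \<ge> M" "j \<ge> M" for i j
    using norm_triangle_ineq4[of "v i - v k" "v j - v k"] near[OF that(1)] near[OF that(2)] by simp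
  then show "\<exists>M. \<forall>i\<ge>M. \<forall>j\<ge>M. norm (v i - v j) < \<epsilon>"
    by blast
qed

theorem resolvent_tendsto_metric_proj:
  fixes A :: "'a::{real_inner, complete_space} \<Rightarrow> 'a set" and \<beta> :: "nat \<Rightarrow> real"
  assumes max: "maximal_monotone_op A" and F: "F = op_inverse A 0" and "F \<noteq> {}"
    and pos: "\<And>n. \<beta> n > 0" and lim: "filterlim \<beta> at_top sequentially"
  shows "(\<lambda>n. resolvent (\<beta> n) A u) \<longlonglongrightarrow> metric_proj F u"
proof -
  have mono: "monotone_op A"
    using max by (simp add: maximal_monotone_op_def)
  have memF: "p \<in> F \<longleftrightarrow> 0 \<in> A p" for p
    by (auto simp: F op_inverse_def op_dom_def)
  define v where "v = (\<lambda>n. u - resolvent (\<beta> n) A u)"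
  have mem: "(1 / \<beta> n) *\<^sub>R v n \<in> A (u - v n)" for n
    using resolvent_mem[OF max pos[of n], of u] by (simp add: v_def)
  have incr: "(norm (v n - v m))\<^sup>2 \<le> (norm (v n))\<^sup>2 - (norm (v m))\<^sup>2" if "\<beta> m \<le> \<beta> n" for m n
  proof (rule norm_diff_sq_le_of_inner_scaled)
    show "1 / \<beta> n \<le> 1 / \<beta> m" "0 \<le> 1 / \<beta> n" "0 < 1 / \<beta> m"
      using that pos[of m] pos[of n] by (auto simp: frac_le)
    show "0 \<le> (v n - v m) \<bullet> ((1 / \<beta> m) *\<^sub>R v m - (1 / \<beta> n) *\<^sub>R v n)"
      using monotone_opD[OF mono mem[of m] mem[of n]] by simp
  qed
  \<comment> \<open>A zero \<open>p\<close> acts as a resolvent value at \<beta> = infinity: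
    \<open>u - p\<close> replaces \<open>v n\<close>, with coefficient 0.\<close>
  have zero_bound: "(norm (u - p - v n))\<^sup>2 \<le> (norm (u - p))\<^sup>2 - (norm (v n))\<^sup>2" if "p \<in> F" for p n
  proof (rule norm_diff_sq_le_of_inner_scaled)
    show "(0::real) \<le> 0" "0 \<le> 1 / \<beta> n" "0 < 1 / \<beta> n"
      using pos[of n] by auto
    show "0 \<le> (u - p - v n) \<bullet> ((1 / \<beta> n) *\<^sub>R v n - 0 *\<^sub>R (u - p))"
      using monotone_opD[OF mono mem[of n], of 0 p] that by (simp add: memF algebra_simps)
  qed
  obtain p0 where "p0 \<in> F"
    using \<open>F \<noteq> {}\<close> by blast
  have "(norm (v n))\<^sup>2 \<le> (norm (u - p0))\<^sup>2" for n
    using zero_bound[OF \<open>p0 \<in> F\<close>, of n] by (smt (verit) zero_le_power2)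
  then have "Cauchy v"
    using Cauchy_of_norm_sq_monotone[of \<beta> v, OF lim incr] by blast
  then obtain v' where v': "v \<longlonglongrightarrow> v'"
    using Cauchy_convergent convergent_def by blast
  \<comment> \<open>This bound gives both halves of the projection property:
    \<open>norm v' \<le> norm (u - p)\<close> shows that \<open>u - v'\<close> is nearest, and
    equality of these norms forces \<open>p = u - v'\<close>.\<close>
  have limit_bound: "(norm (u - p - v'))\<^sup>2 \<le> (norm (u - p))\<^sup>2 - (norm v')\<^sup>2" if "p \<in> F" for p
  proof (rule LIMSEQ_le)
    show "(\<lambda>n. (norm (u - p - v n))\<^sup>2) \<longlonglongrightarrow> (norm (u - p - v'))\<^sup>2"
      "(\<lambda>n. (norm (u - p))\<^sup>2 - (norm (v n))\<^sup>2) \<longlonglongrightarrow> (norm (u - p))\<^sup>2 - (norm v')\<^sup>2"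
      by (intro tendsto_intros v')+
  qed (use zero_bound[OF that] in blast)
  have x': "(\<lambda>n. u - v n) \<longlonglongrightarrow> u - v'"
    by (intro tendsto_intros v')
  have "((\<lambda>n. 1 / \<beta> n) \<longlongrightarrow> 0) sequentially"
    by (rule tendsto_divide_0[OF tendsto_const filterlim_at_top_imp_at_infinity[OF lim]])
  then have "(\<lambda>n. (1 / \<beta> n) *\<^sub>R v n) \<longlonglongrightarrow> 0"
    using tendsto_scaleR[OF _ v'] by fastforce
  then have "0 \<in> A (u - v')"
    using maximal_monotone_op_graph_closed[OF max mem x'] by blast
  then have "u - v' \<in> F"
    by (simp add: memF)
  have "metric_proj F u = u - v'"
    unfolding metric_proj_def
  proof (rule the_equality)
    have "norm v' \<le> norm (u - q)" if "q \<in> F" for q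
    proof (rule power2_le_imp_le)
      show "(norm v')\<^sup>2 \<le> (norm (u - q))\<^sup>2"
        using limit_bound[OF that] zero_le_power2[of "norm (u - q - v')"] by linarith
    qed simp
    then show "u - v' \<in> F \<and> (\<forall>q\<in>F. dist u (u - v') \<le> dist u q)"
      using \<open>u - v' \<in> F\<close> by (auto simp: dist_norm)
  next
    fix p
    assume p: "p \<in> F \<and> (\<forall>q\<in>F. dist u p \<le> dist u q)"
    then have "norm (u - p) \<le> norm v'"
      using \<open>u - v' \<in> F\<close> by (force simp: dist_norm)
    then have "(norm (u - p))\<^sup>2 \<le> (norm v')\<^sup>2"
      by (simp add: power_mono)
    with limit_bound[of p] p have "(norm (u - p - v'))\<^sup>2 \<le> 0"
      by linarith
    then show "p = u - v'"
      by (simp add: algebra_simps)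
  qed
  with x' show ?thesis
    by (simp add: v_def)
qed

section \<open>The perturbed iteration\<close>

lemma contractive_recursion_tendsto_zero:
  fixes s a d :: "nat \<Rightarrow> real"
  assumes "\<And>n. 0 \<le> s n" "\<And>n. 0 \<le> a n" "a \<longlonglongrightarrow> 0" "d \<longlonglongrightarrow> 0"
    and rec: "\<And>n. s (Suc n) \<le> a n * s n + d n"
  shows "s \<longlonglongrightarrow> 0"
proof -
  have "\<forall>\<^sub>F n in sequentially. a n < 1/2" "\<forall>\<^sub>F n in sequentially. d n < 1"
    using order_tendstoD(2)[OF assms(3), of "1/2"] order_tendstoD(2)[OF assms(4), of 1] by simp_all
  then have "\<forall>\<^sub>F n in sequentially. a n < 1/2 \<and> d n < 1"
    by eventually_elim simp
  then obtain N where N: "\<And>n. n \<ge> N \<Longrightarrow> a n < 1/2 \<and> d n < 1"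
    by (auto simp: eventually_sequentially)
  \<comment> \<open>The value 2 is the fixed point of \<open>r \<mapsto> r / 2 + 1\<close>, so the
    recursion cannot leave \<open>[0, M]\<close> once \<open>a n < 1/2\<close> and
    \<open>d n < 1\<close>.\<close>
  define M where "M = max (s N) 2"
  have bound: "s n \<le> M" if "n \<ge> N" for n
    using that
  proof (induction n rule: dec_induct)
    case (step n)
    have "a n * s n \<le> 1/2 * M"
      using step N[of n] assms(1,2) by (intro mult_mono) (auto simp: M_def)
    moreover have "d n < 1" "M \<ge> 2"
      using step N by (auto simp: M_def)
    ultimately show ?case
      using rec[of n] by linarith
  qed (simp add: M_def)
  have "s (Suc n) \<le> a n * M + d n" if "n \<ge> N" for n
    using rec[of n] mult_left_mono[OF bound[OF that] assms(2)] by (smt (verit))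
  then have upper: "\<forall>\<^sub>F n in sequentially. s (Suc n) \<le> a n * M + d n"
    by (auto simp: eventually_sequentially)
  have "(\<lambda>n. s (Suc n)) \<longlonglongrightarrow> 0"
  proof (rule tendsto_sandwich[OF _ upper])
    show "\<forall>\<^sub>F n in sequentially. 0 \<le> s (Suc n)"
      using assms(1) by simp
    show "(\<lambda>n. a n * M + d n) \<longlonglongrightarrow> 0"
      using tendsto_add[OF tendsto_mult_right[OF assms(3)] assms(4), of M] by simp
  qed simp
  then show ?thesis
    by (simp add: filterlim_sequentially_Suc)
qed

theorem theorem2p1:
  fixes A :: "'a::{real_inner, complete_space} \<Rightarrow> 'a set"
    and F :: "'a set"
    and \<beta> \<alpha> :: "nat \<Rightarrow> real"
    and e u x :: "nat \<Rightarrow> 'a"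
    and u_lim x0 :: 'a
  assumes "maximal_monotone_op A"
    and "F = op_inverse A 0"
    and "F \<noteq> {}"
    and "\<And>n. \<beta> n > 0"
    and "filterlim \<beta> at_top sequentially"
    and "\<alpha> \<longlonglongrightarrow> 0"
    and "(\<lambda>n. \<alpha> n *\<^sub>R e n) \<longlonglongrightarrow> 0"
    and "u \<longlonglongrightarrow> u_lim"
    and "x 0 = x0"
    and "\<And>n. x (Suc n) = resolvent (\<beta> n) A (u n + \<alpha> n *\<^sub>R (x n + e n))"
  shows "x \<longlonglongrightarrow> metric_proj F u_lim"
proof -
  define P where "P = metric_proj F u_lim"
  define y where "y = (\<lambda>n. resolvent (\<beta> n) A u_lim)"
  have y: "y \<longlonglongrightarrow> P"
    unfolding y_def P_def by (rule resolvent_tendsto_metric_proj[OF assms(1-5)])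
  \<comment> \<open>Everything in the error estimate that is not proportional to
    \<open>norm (x n - P)\<close>.\<close>
  define d where
    "d = (\<lambda>n. norm (y n - P) + norm (u n - u_lim) + \<bar>\<alpha> n\<bar> * norm P + norm (\<alpha> n *\<^sub>R e n))"
  have "(\<lambda>n. norm (x n - P)) \<longlonglongrightarrow> 0"
  proof (rule contractive_recursion_tendsto_zero)
    show "(\<lambda>n. \<bar>\<alpha> n\<bar>) \<longlonglongrightarrow> 0"
      using assms(6) by (simp add: tendsto_rabs_zero)
    have "d \<longlonglongrightarrow> norm (P - P) + norm (u_lim - u_lim) + \<bar>0\<bar> * norm P + norm (0::'a)"
      unfolding d_def by (intro tendsto_intros y assms(6-8))
    then show "d \<longlonglongrightarrow> 0" by simp
  next
    fix n
    \<comment> \<open>Both points are values of the same resolvent, so nonexpansiveness compares the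
      arguments. Splitting \<open>x n\<close> around \<open>P\<close> then produces the coefficient
      \<open>\<bar>\<alpha> n\<bar>\<close> of the recursion.\<close>
    have "norm (x (Suc n) - y n) \<le> norm (u n + \<alpha> n *\<^sub>R (x n + e n) - u_lim)"
      using resolvent_nonexpansive[OF assms(1) assms(4)] by (simp add: assms(10) y_def dist_norm)
    also have "u n + \<alpha> n *\<^sub>R (x n + e n) - u_lim =
        (u n - u_lim) + \<alpha> n *\<^sub>R (x n - P) + \<alpha> n *\<^sub>R P + \<alpha> n *\<^sub>R e n"
      by (simp add: algebra_simps)
    also have "norm \<dots> \<le>
        norm (u n - u_lim) + \<bar>\<alpha> n\<bar> * norm (x n - P) + \<bar>\<alpha> n\<bar> * norm P + norm (\<alpha> n *\<^sub>R e n)"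
      by (intro norm_triangle_le add_mono) auto
    finally show "norm (x (Suc n) - P) \<le> \<bar>\<alpha> n\<bar> * norm (x n - P) + d n"
      using norm_triangle_ineq[of "x (Suc n) - y n" "y n - P"] by (simp add: d_def)
  qed auto
  then show ?thesis
    unfolding P_def by (simp add: LIM_zero_iff tendsto_norm_zero_iff)
qed

end
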